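(* Let $d\in\mathbb{N}$, and for every $i\in\{0,1,\dots,k+1\}$ let a feasible solution of the sum-of-squares program $\mathbf{M}_d(i)$ be given, with associated polynomial $p_i^{(d)}(\boldsymbol a)=\sum_{\alpha}\mathrm{p}^i_\alpha\boldsymbol a^\alpha$. Put $R^{(d)}(i)=\{\boldsymbol a\in C_{\boldsymbol a}\mid p_i^{(d)}(\boldsymbol a)\le 0\}$ and $R^{(d)}=\bigcap_{i=0}^{k+1}R^{(d)}(i)$. Then $R^{(d)}$ is an underapproximation of the valid set $R_I$, i.e. $R^{(d)}\subseteq R_I$.
   Context: Program data. $\boldsymbol x\in\mathbb{R}^n$ is the program state. The program is a loop with a precondition $\mathit{Pre}(\boldsymbol x)\le 0$, a postcondition $\mathit{Post}(\boldsymbol x)\le 0$, and $k$ branches: branch $i$ has guard $\boldsymbol c_i(\boldsymbol x)\le 0$ and assignment $\boldsymbol x:=\boldsymbol f_i(\boldsymbol x)$, $i=1,\dots,k$ (the guards are pairwise non-intersecting). Here $\mathit{Pre},\mathit{Post}$ are real polynomials and $\boldsymbol c_i,\boldsymbol f_i$ are (vector-valued) polynomial maps; inequalities between vectors are componentwise. States stay in a known compact set $C_{\boldsymbol x}=\{\boldsymbol x\in\mathbb{R}^n\mid h^{\boldsymbol x}_r(\boldsymbol x)\le 0,\ r=1,\dots,s_{\boldsymbol x}\}$, and a polynomial template $I(\boldsymbol a,\boldsymbol x)\in\mathbb{R}[\boldsymbol a,\boldsymbol x]$ is given with parameters $\boldsymbol a$ in a known compact set $C_{\boldsymbol a}=\{\boldsymbol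 a\in\mathbb{R}^m\mid h^{\boldsymbol a}_r(\boldsymbol a)\le 0,\ r=1,\dots,s_{\boldsymbol a}\}$ with $\mu(C_{\boldsymbol a})>0$; all $h^{\boldsymbol x}_r,h^{\boldsymbol a}_r$ are polynomials, and $\mu$ is Lebesgue measure. Valid set. $R_I=\bigcap_{i=0}^{k+1}R_I(i)$, where $R_I(0)=\{\boldsymbol a\in C_{\boldsymbol a}\mid\forall\boldsymbol x\in C_{\boldsymbol x}.\ \mathit{Pre}(\boldsymbol x)\le 0\Rightarrow I(\boldsymbol a,\boldsymbol x)\le 0\}$; $R_I(i)=\{\boldsymbol a\in C_{\boldsymbol a}\mid\forall\boldsymbol x\in C_{\boldsymbol x}.\ (\boldsymbol c_i(\boldsymbol x)\le 0\wedge I(\boldsymbol a,\boldsymbol x)\le 0)\Rightarrow I(\boldsymbol a,\boldsymbol f_i(\boldsymbol x))\le 0\}$ for $i=1,\dots,k$; $R_I(k+1)=\{\boldsymbol a\in C_{\boldsymbol a}\mid\forall\boldsymbol x\in C_{\boldsymbol x}.\ (\bigwedge_{i=1}^k\boldsymbol c_i(\boldsymbol x)\ge 0\wedge I(\boldsymbol a,\boldsymbol x)\le 0)\Rightarrow\mathit{Post}(\boldsymbol x)\le 0\}$. Each has the form $R_I(i)=\{\boldsymbol a\in C_{\boldsymbol a}\mid\forall\boldsymbol x\in\mathbf{K}_i(\boldsymbol a).\ l_i(\boldsymbol a,\boldsymbol x)\le 0\}$, where $\mathbf{K}_i(\boldsymbol a)=\{\boldsymbol x\in C_{\boldsymbol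 x}\mid g_{ir}(\boldsymbol a,\boldsymbol x)\le 0,\ r=1,\dots,m_i\}$, the polynomials $g_{ir}$ encode the premise of the $i$-th implication (with $\boldsymbol c_i\ge0$ written as $-\boldsymbol c_i\le0$), and $l_0=I(\boldsymbol a,\boldsymbol x)$, $l_i=I(\boldsymbol a,\boldsymbol f_i(\boldsymbol x))$ for $1\le i\le k$, $l_{k+1}=\mathit{Post}(\boldsymbol x)$. SOS program. Fix a real $M>0$. A quadratic module generated by $q_1,\dots,q_N$ is $\{\sigma_0+\sum_j\sigma_jq_j\}$ with $\sigma_j$ sums of squares; it is Archimedean if it contains $C-\|\cdot\|^2$ for some $C>0$. The quadratic modules corresponding to the inequality descriptions of $\mathbf{K}_i(\boldsymbol a)$, $C_{\boldsymbol a}$ and $C_{\boldsymbol x}$ (generated by the negatives of the polynomials required to be $\le 0$) are assumed Archimedean. For $d\in\mathbb{N}$, the program $\mathbf{M}_d(i)$ is: minimize $\sum_\alpha\gamma_\alpha\mathrm{p}^i_\alpha$ over real numbers $\mathrm{p}^i_\alpha$ ($|\alpha|\le 2d$) and sum-of-squares polynomials $\sigma_i,\sigma^K_{ir},\sigma^{\boldsymbol a}_{ir},\sigma^{\boldsymbol x}_{ir},\sigma'_i,\sigma'^K_{ir},\sigma'^{\boldsymbol a}_{ir},\sigma'^{\boldsymbol x}_{ir}$ in $(\boldsymbol a,\boldsymbol x)$ of degree at most $2d$, subject to the polynomial identities $p_i(\boldsymbol a)-l_i(\boldsymbol a,\boldsymbol x)=\sigma_i-\sum_{r=1}^{m_i}\sigma^K_{ir}g_{ir}-\sum_{r=1}^{s_{\boldsymbol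 a}}\sigma^{\boldsymbol a}_{ir}h^{\boldsymbol a}_r-\sum_{r=1}^{s_{\boldsymbol x}}\sigma^{\boldsymbol x}_{ir}h^{\boldsymbol x}_r$, $p_i(\boldsymbol a)+M=\sigma'_i-\sum_{r=1}^{m_i}\sigma'^K_{ir}g_{ir}-\sum_{r=1}^{s_{\boldsymbol a}}\sigma'^{\boldsymbol a}_{ir}h^{\boldsymbol a}_r-\sum_{r=1}^{s_{\boldsymbol x}}\sigma'^{\boldsymbol x}_{ir}h^{\boldsymbol x}_r$, where $p_i(\boldsymbol a)=\sum_{|\alpha|\le 2d}\mathrm{p}^i_\alpha\boldsymbol a^\alpha$ and $\gamma_\alpha=\frac{1}{\mu(C_{\boldsymbol a})}\int_{C_{\boldsymbol a}}\boldsymbol a^\alpha\,d\mu(\boldsymbol a)$. *)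

theory Defs
  imports "HOL-Analysis.Analysis" "HOL-Library.Poly_Mapping"
begin

section \<open>Real multivariate polynomials\<close>

text \<open>A polynomial is a finitely supported map from exponent vectors to coefficients;
  addition and multiplication are those of \<^theory>\<open>HOL-Library.Poly_Mapping\<close>
  (convolution product), so equations between such objects are formal polynomial identities.\<close>

type_synonym 'v monom = "'v \<Rightarrow>\<^sub>0 nat"
type_synonym 'v mpoly = "'v monom \<Rightarrow>\<^sub>0 real"

definition Const :: "real \<Rightarrow> 'v mpoly" where
  "Const c = Poly_Mapping.single 0 c"

definition Var :: "'v \<Rightarrow> 'v mpoly" where
  "Var v = Poly_Mapping.single (Poly_Mapping.single v 1) 1"

definition monom_val :: "('v \<Rightarrow> 'r::comm_semiring_1) \<Rightarrow> 'v monom \<Rightarrow> 'r" where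
  "monom_val s \<alpha> = (\<Prod>v\<in>Poly_Mapping.keys \<alpha>. s v ^ Poly_Mapping.lookup \<alpha> v)"

definition peval :: "('v \<Rightarrow> real) \<Rightarrow> 'v mpoly \<Rightarrow> real" where
  "peval s p = (\<Sum>\<alpha>\<in>Poly_Mapping.keys p. Poly_Mapping.lookup p \<alpha> * monom_val s \<alpha>)"

definition psubst :: "('v \<Rightarrow> 'w mpoly) \<Rightarrow> 'v mpoly \<Rightarrow> 'w mpoly" where
  "psubst s p = (\<Sum>\<alpha>\<in>Poly_Mapping.keys p. Const (Poly_Mapping.lookup p \<alpha>) * monom_val s \<alpha>)"

definition monom_degree :: "'v monom \<Rightarrow> nat" where
  "monom_degree \<alpha> = (\<Sum>v\<in>Poly_Mapping.keys \<alpha>. Poly_Mapping.lookup \<alpha> v)"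

definition degree_le :: "nat \<Rightarrow> 'v mpoly \<Rightarrow> bool" where
  "degree_le D p \<longleftrightarrow> (\<forall>\<alpha>\<in>Poly_Mapping.keys p. monom_degree \<alpha> \<le> D)"

definition sos :: "'v mpoly \<Rightarrow> bool" where
  "sos p \<longleftrightarrow> (\<exists>qs. p = (\<Sum>q\<leftarrow>qs. q\<^sup>2))"

definition sos_le :: "nat \<Rightarrow> 'v mpoly \<Rightarrow> bool" where
  "sos_le D p \<longleftrightarrow> sos p \<and> degree_le D p"

definition quadratic_module :: "'v mpoly list \<Rightarrow> 'v mpoly set" where
  "quadratic_module qs =
     {\<sigma>0 + (\<Sum>j<length qs. \<sigma> j * qs ! j) | \<sigma>0 \<sigma>. sos \<sigma>0 \<and> (\<forall>j<length qs. sos (\<sigma> j))}"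

definition archimedean :: "'v::finite mpoly set \<Rightarrow> bool" where
  "archimedean Q \<longleftrightarrow> (\<exists>C>0. Const C - (\<Sum>v\<in>UNIV. (Var v)\<^sup>2) \<in> Q)"

text \<open>Polynomials in $(a,x)$ use the variable type \<^typ>\<open>'m + 'n\<close>, with the parameters on the
  left and the program variables on the right.\<close>

abbreviation pt :: "real^'v \<Rightarrow> 'v \<Rightarrow> real" where
  "pt x \<equiv> (\<lambda>j. x $ j)"

abbreviation joint_pt :: "real^'m \<Rightarrow> real^'n \<Rightarrow> 'm + 'n \<Rightarrow> real" where
  "joint_pt a x \<equiv> case_sum (pt a) (pt x)"

definition of_param :: "'m mpoly \<Rightarrow> ('m + 'n) mpoly" where
  "of_param = psubst (\<lambda>j. Var (Inl j))"

definition of_state :: "'n mpoly \<Rightarrow> ('m + 'n) mpoly" where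
  "of_state = psubst (\<lambda>j. Var (Inr j))"

definition fix_param :: "real^'m \<Rightarrow> ('m + 'n) mpoly \<Rightarrow> 'n mpoly" where
  "fix_param a = psubst (case_sum (\<lambda>j. Const (a $ j)) Var)"

section \<open>Loops, templates and the valid set\<close>

text \<open>Branches are numbered from 1 to \<open>num_branches\<close>; values of \<open>guard\<close> and \<open>assignment\<close> at
  other indices are never used. A guard is the list of its components. The fields
  \<open>state_ineqs\<close> and \<open>param_ineqs\<close> list the polynomials required to be nonpositive on the compact
  sets of states and parameters.\<close>

record ('m::finite, 'n::finite) problem =
  precond :: "'n mpoly"
  postcond :: "'n mpoly"
  num_branches :: nat
  guard :: "nat \<Rightarrow> 'n mpoly list"
  assignment :: "nat \<Rightarrow> 'n mpoly ^ 'n"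
  state_ineqs :: "'n mpoly list"
  param_ineqs :: "'m mpoly list"
  template :: "('m + 'n) mpoly"

definition state_set :: "('m::finite, 'n::finite) problem \<Rightarrow> (real^'n) set" where
  "state_set P = {x. \<forall>h\<in>set (state_ineqs P). peval (pt x) h \<le> 0}"

definition param_set :: "('m::finite, 'n::finite) problem \<Rightarrow> (real^'m) set" where
  "param_set P = {a. \<forall>h\<in>set (param_ineqs P). peval (pt a) h \<le> 0}"

definition guard_holds :: "('m::finite, 'n::finite) problem \<Rightarrow> nat \<Rightarrow> real^'n \<Rightarrow> bool" where
  "guard_holds P i x \<longleftrightarrow> (\<forall>q\<in>set (guard P i). peval (pt x) q \<le> 0)"

text \<open>The exit condition of the loop is the closed condition that every component of every
  guard is nonnegative, not the negation of all the guards.\<close>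

definition exit_holds :: "('m::finite, 'n::finite) problem \<Rightarrow> real^'n \<Rightarrow> bool" where
  "exit_holds P x \<longleftrightarrow> (\<forall>i\<in>{1..num_branches P}. \<forall>q\<in>set (guard P i). peval (pt x) q \<ge> 0)"

definition next_state :: "('m::finite, 'n::finite) problem \<Rightarrow> nat \<Rightarrow> real^'n \<Rightarrow> real^'n" where
  "next_state P i x = (\<chi> j. peval (pt x) (assignment P i $ j))"

inductive_set reachable :: "('m::finite, 'n::finite) problem \<Rightarrow> (real^'n) set" for P :: "('m::finite, 'n::finite) problem" where
  initial: "x \<in> state_set P \<Longrightarrow> peval (pt x) (precond P) \<le> 0 \<Longrightarrow> x \<in> reachable P"
| step: "x \<in> reachable P \<Longrightarrow> i \<in> {1..num_branches P} \<Longrightarrow> guard_holds P i x \<Longrightarrow>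
    next_state P i x \<in> reachable P"

definition tmpl_holds :: "('m::finite, 'n::finite) problem \<Rightarrow> real^'m \<Rightarrow> real^'n \<Rightarrow> bool" where
  "tmpl_holds P a x \<longleftrightarrow> peval (joint_pt a x) (template P) \<le> 0"

definition valid_part :: "('m::finite, 'n::finite) problem \<Rightarrow> nat \<Rightarrow> (real^'m) set" where
  "valid_part P i =
    (if i = 0 then
       {a \<in> param_set P. \<forall>x\<in>state_set P. peval (pt x) (precond P) \<le> 0 \<longrightarrow> tmpl_holds P a x}
     else if i \<le> num_branches P then
       {a \<in> param_set P. \<forall>x\<in>state_set P.
          guard_holds P i x \<and> tmpl_holds P a x \<longrightarrow> tmpl_holds P a (next_state P i x)}
     else
       {a \<in> param_set P. \<forall>x\<in>state_set P.
          exit_holds P x \<and> tmpl_holds P a x \<longrightarrow> peval (pt x) (postcond P) \<le> 0})"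

definition valid_set :: "('m::finite, 'n::finite) problem \<Rightarrow> (real^'m) set" where
  "valid_set P = (\<Inter>i\<in>{0..num_branches P + 1}. valid_part P i)"

section \<open>The sum-of-squares programs\<close>

definition premise_polys :: "('m::finite, 'n::finite) problem \<Rightarrow> nat \<Rightarrow> ('m + 'n) mpoly list" where
  "premise_polys P i =
    (if i = 0 then [of_state (precond P)]
     else if i \<le> num_branches P then map of_state (guard P i) @ [template P]
     else concat (map (\<lambda>j. map (\<lambda>q. - of_state q) (guard P j)) [1..<Suc (num_branches P)])
            @ [template P])"

definition concl_poly :: "('m::finite, 'n::finite) problem \<Rightarrow> nat \<Rightarrow> ('m + 'n) mpoly" where
  "concl_poly P i =
    (if i = 0 then template P
     else if i \<le> num_branches P then
       psubst (case_sum (\<lambda>j. Var (Inl j)) (\<lambda>j. of_state (assignment P i $ j))) (template P)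
     else of_state (postcond P))"

definition K_module :: "('m::finite, 'n::finite) problem \<Rightarrow> nat \<Rightarrow> real^'m \<Rightarrow> 'n mpoly set" where
  "K_module P i a =
     quadratic_module (map uminus (map (fix_param a) (premise_polys P i) @ state_ineqs P))"

definition state_module :: "('m::finite, 'n::finite) problem \<Rightarrow> 'n mpoly set" where
  "state_module P = quadratic_module (map uminus (state_ineqs P))"

definition param_module :: "('m::finite, 'n::finite) problem \<Rightarrow> 'm mpoly set" where
  "param_module P = quadratic_module (map uminus (param_ineqs P))"

datatype 'z minimization = Minimize (objective: "'z \<Rightarrow> real") (feasible: "'z set")

text \<open>The real unknowns of the program are the coefficients of \<open>bound\<close>. The multiplier families
  indexed by \<^typ>\<open>nat\<close> are constrained and used only below the length of the corresponding list
  of inequalities. Primed fields belong to the second identity.\<close>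

record ('m, 'n) sos_point =
  bound :: "'m mpoly"
  sig :: "('m + 'n) mpoly"
  sigK :: "nat \<Rightarrow> ('m + 'n) mpoly"
  sigA :: "nat \<Rightarrow> ('m + 'n) mpoly"
  sigX :: "nat \<Rightarrow> ('m + 'n) mpoly"
  sig' :: "('m + 'n) mpoly"
  sigK' :: "nat \<Rightarrow> ('m + 'n) mpoly"
  sigA' :: "nat \<Rightarrow> ('m + 'n) mpoly"
  sigX' :: "nat \<Rightarrow> ('m + 'n) mpoly"

definition weighted :: "(nat \<Rightarrow> 'v mpoly) \<Rightarrow> 'v mpoly list \<Rightarrow> 'v mpoly" where
  "weighted \<sigma> qs = (\<Sum>r<length qs. \<sigma> r * qs ! r)"

definition param_moment :: "('m::finite, 'n::finite) problem \<Rightarrow> 'm monom \<Rightarrow> real" where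
  "param_moment P \<alpha> =
     1 / measure lebesgue (param_set P) *
     set_lebesgue_integral lebesgue (param_set P) (\<lambda>a. monom_val (pt a) \<alpha>)"

definition sos_program ::
    "('m::finite, 'n::finite) problem \<Rightarrow> real \<Rightarrow> nat \<Rightarrow> nat \<Rightarrow> ('m, 'n) sos_point minimization" where
  "sos_program P M d i =
    (let g = premise_polys P i;
         hA = map of_param (param_ineqs P);
         hX = map of_state (state_ineqs P)
     in Minimize
       (\<lambda>z. \<Sum>\<alpha>\<in>Poly_Mapping.keys (bound z).
              param_moment P \<alpha> * Poly_Mapping.lookup (bound z) \<alpha>)
       {z. degree_le (2 * d) (bound z)
         \<and> sos_le (2 * d) (sig z) \<and> sos_le (2 * d) (sig' z)
         \<and> (\<forall>r<length g. sos_le (2 * d) (sigK z r) \<and> sos_le (2 * d) (sigK' z r))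
         \<and> (\<forall>r<length hA. sos_le (2 * d) (sigA z r) \<and> sos_le (2 * d) (sigA' z r))
         \<and> (\<forall>r<length hX. sos_le (2 * d) (sigX z r) \<and> sos_le (2 * d) (sigX' z r))
         \<and> of_param (bound z) - concl_poly P i =
             sig z - weighted (sigK z) g - weighted (sigA z) hA - weighted (sigX z) hX
         \<and> of_param (bound z) + Const M =
             sig' z - weighted (sigK' z) g - weighted (sigA' z) hA - weighted (sigX' z) hX})"

definition under_part :: "('m::finite, 'n::finite) problem \<Rightarrow> 'm mpoly \<Rightarrow> (real^'m) set" where
  "under_part P p = {a \<in> param_set P. peval (pt a) p \<le> 0}"

definition under_set :: "('m::finite, 'n::finite) problem \<Rightarrow> (nat \<Rightarrow> 'm mpoly) \<Rightarrow> (real^'m) set" where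
  "under_set P p = (\<Inter>i\<in>{0..num_branches P + 1}. under_part P (p i))"

end

theory Submission
  imports Defs
begin

text \<open>Evaluation at a point \<open>(a, x)\<close> is a ring homomorphism that is nonnegative on sums of squares.
  If \<open>a\<close> and \<open>x\<close> satisfy all the inequalities of the \<open>i\<close>-th implication, the first identity of the
  program therefore gives \<open>l\<^sub>i (a, x) \<le> p\<^sub>i a\<close>, and \<open>p\<^sub>i a \<le> 0\<close> by the choice of \<open>a\<close>.\<close>

text \<open>Coefficients outside the support vanish. Sums for different polynomials can thus be
  taken over one index set, even when terms cancel in \<open>p + q\<close>.\<close>

lemma peval_superset:
  assumes "finite A" "Poly_Mapping.keys p \<subseteq> A"
  shows "peval s p = (\<Sum>\<alpha>\<in>A. Poly_Mapping.lookup p \<alpha> * monom_val s \<alpha>)"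
  unfolding peval_def using assms by (intro sum.mono_neutral_left) (auto simp: in_keys_iff)

lemma peval_add: "peval s (p + q) = peval s p + peval s q"
proof -
  let ?A = "Poly_Mapping.keys p \<union> Poly_Mapping.keys q"
  have "peval s (p + q) = (\<Sum>\<alpha>\<in>?A. Poly_Mapping.lookup (p + q) \<alpha> * monom_val s \<alpha>)"
    by (rule peval_superset) (use Poly_Mapping.keys_add[of p q] in auto)
  also have "\<dots> = peval s p + peval s q"
    by (simp add: peval_superset[of ?A] lookup_add distrib_right sum.distrib)
  finally show ?thesis .
qed

lemma peval_0 [simp]: "peval s 0 = 0"
  by (simp add: peval_def)

lemma peval_uminus: "peval s (- p) = - peval s p"
  using peval_add[of s p "- p"] by simp

lemma peval_diff: "peval s (p - q) = peval s p - peval s q"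
  using peval_add[of s p "- q"] by (simp add: peval_uminus)

lemma peval_sum: "peval s (\<Sum>i\<in>A. f i) = (\<Sum>i\<in>A. peval s (f i))"
  by (induction A rule: infinite_finite_induct) (simp_all add: peval_add)

lemma peval_single: "peval s (Poly_Mapping.single \<alpha> c) = c * monom_val s \<alpha>"
  by (simp add: peval_def)

lemma monom_val_0 [simp]: "monom_val s 0 = 1"
  by (simp add: monom_val_def)

lemma monom_val_superset:
  assumes "finite A" "Poly_Mapping.keys \<alpha> \<subseteq> A"
  shows "monom_val s \<alpha> = (\<Prod>v\<in>A. s v ^ Poly_Mapping.lookup \<alpha> v)"
  unfolding monom_val_def using assms by (intro prod.mono_neutral_left) (auto simp: in_keys_iff)

lemma monom_val_add: "monom_val s (\<alpha> + \<beta>) = monom_val s \<alpha> * monom_val s \<beta>"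
proof -
  let ?A = "Poly_Mapping.keys \<alpha> \<union> Poly_Mapping.keys \<beta>"
  have "monom_val s (\<alpha> + \<beta>) = (\<Prod>v\<in>?A. s v ^ Poly_Mapping.lookup (\<alpha> + \<beta>) v)"
    by (rule monom_val_superset) (use Poly_Mapping.keys_add[of \<alpha> \<beta>] in auto)
  also have "\<dots> = monom_val s \<alpha> * monom_val s \<beta>"
    by (simp add: monom_val_superset[of ?A] lookup_add power_add prod.distrib)
  finally show ?thesis .
qed

lemma peval_mult: "peval s (p * q) = peval s p * peval s q"
proof -
  let ?m = "\<lambda>r \<alpha>. Poly_Mapping.single \<alpha> (Poly_Mapping.lookup r \<alpha>)"
  \<comment> \<open>Splitting both factors into single terms reduces the convolution product to
    \<open>mult_single\<close>, where exponents add and \<open>monom_val_add\<close>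
    applies.\<close>
  have sum_monoms: "r = (\<Sum>\<alpha>\<in>Poly_Mapping.keys r. ?m r \<alpha>)" for r :: "'a mpoly"
    by (rule poly_mapping_eqI) (simp add: lookup_sum lookup_single when_def in_keys_iff)
  have "peval s (p * q)
      = peval s (\<Sum>\<alpha>\<in>Poly_Mapping.keys p. \<Sum>\<beta>\<in>Poly_Mapping.keys q. ?m p \<alpha> * ?m q \<beta>)"
    by (subst sum_monoms[of p], subst sum_monoms[of q]) (simp only: sum_product)
  also have "\<dots> = (\<Sum>\<alpha>\<in>Poly_Mapping.keys p. \<Sum>\<beta>\<in>Poly_Mapping.keys q.
      (Poly_Mapping.lookup p \<alpha> * monom_val s \<alpha>) * (Poly_Mapping.lookup q \<beta> * monom_val s \<beta>))"
    by (simp add: peval_sum mult_single peval_single monom_val_add mult_ac)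
  also have "\<dots> = peval s p * peval s q"
    by (simp add: peval_def sum_product)
  finally show ?thesis .
qed

lemma peval_Const [simp]: "peval s (Const c) = c"
  by (simp add: Const_def peval_single)

lemma peval_Var [simp]: "peval s (Var v) = s v"
  by (simp add: Var_def peval_single monom_val_def)

lemma peval_1 [simp]: "peval s 1 = 1"
  using peval_Const[of s 1] by (simp add: Const_def)

lemma peval_power: "peval s (p ^ k) = peval s p ^ k"
  by (induction k) (simp_all add: peval_mult)

lemma peval_prod: "peval s (\<Prod>i\<in>A. f i) = (\<Prod>i\<in>A. peval s (f i))"
  by (induction A rule: infinite_finite_induct) (simp_all add: peval_mult)

lemma peval_monom_val: "peval s (monom_val t \<alpha>) = monom_val (\<lambda>v. peval s (t v)) \<alpha>"
  by (simp add: monom_val_def peval_prod peval_power)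

lemma peval_psubst: "peval s (psubst t p) = peval (\<lambda>v. peval s (t v)) p"
  \<comment> \<open>The homomorphism rules must first push the outer \<open>peval\<close> through
    the substituted sum; only then may \<open>peval_def\<close> be unfolded.\<close>
  by (simp add: psubst_def peval_sum peval_mult peval_monom_val) (simp add: peval_def)

lemma peval_of_param [simp]: "peval (joint_pt a x) (of_param p) = peval (pt a) p"
  by (simp add: of_param_def peval_psubst)

lemma peval_of_state [simp]: "peval (joint_pt a x) (of_state p) = peval (pt x) p"
  by (simp add: of_state_def peval_psubst)

lemma peval_sos_nonneg:
  assumes "sos p"
  shows "peval s p \<ge> 0"
proof -
  have "peval s (\<Sum>q\<leftarrow>qs. q\<^sup>2) \<ge> 0" for qs
    by (induction qs) (simp_all add: peval_add peval_power)
  with assms show ?thesis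
    by (auto simp: sos_def)
qed

text \<open>Every summand is a nonnegative multiplier times a nonpositive value. Subtracting such a
  sum, as the program's identities do, can only raise the right-hand side.\<close>

lemma peval_weighted_nonpos:
  assumes "\<forall>r<length qs. sos (\<sigma> r)" "\<forall>q\<in>set qs. peval s q \<le> 0"
  shows "peval s (weighted \<sigma> qs) \<le> 0"
  unfolding weighted_def peval_sum peval_mult
  using assms by (intro sum_nonpos mult_nonneg_nonpos) (auto intro: peval_sos_nonneg)

lemma peval_concl_poly_le_bound:
  fixes P :: "('m::finite, 'n::finite) problem"
  assumes z: "z \<in> feasible (sos_program P M d i)"
    and a: "a \<in> param_set P" and x: "x \<in> state_set P"
    and g: "\<forall>q\<in>set (premise_polys P i). peval (joint_pt a x) q \<le> 0"
  shows "peval (joint_pt a x) (concl_poly P i) \<le> peval (pt a) (bound z)"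
proof -
  let ?e = "peval (joint_pt a x)"
  let ?g = "premise_polys P i"
  let ?hA = "map of_param (param_ineqs P) :: ('m + 'n) mpoly list"
  let ?hX = "map of_state (state_ineqs P) :: ('m + 'n) mpoly list"
  from z have sos: "sos (sig z)" "\<forall>r<length ?g. sos (sigK z r)"
      "\<forall>r<length ?hA. sos (sigA z r)" "\<forall>r<length ?hX. sos (sigX z r)"
    and id: "of_param (bound z) - concl_poly P i =
      sig z - weighted (sigK z) ?g - weighted (sigA z) ?hA - weighted (sigX z) ?hX"
    by (auto simp: sos_program_def Let_def sos_le_def)
  have "?e (sig z) \<ge> 0"
    by (rule peval_sos_nonneg) (rule sos(1))
  moreover have "?e (weighted (sigK z) ?g) \<le> 0"
    by (rule peval_weighted_nonpos) (rule sos(2), rule g)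
  \<comment> \<open>A lifted parameter inequality takes its value at \<open>a\<close> alone, so
    membership in \<open>param_set P\<close> bounds it; the state inequalities are handled the same
    way with \<open>x\<close>.\<close>
  moreover have "?e (weighted (sigA z) ?hA) \<le> 0"
    by (rule peval_weighted_nonpos) (rule sos(3), use a in \<open>simp add: param_set_def\<close>)
  moreover have "?e (weighted (sigX z) ?hX) \<le> 0"
    by (rule peval_weighted_nonpos) (rule sos(4), use x in \<open>simp add: state_set_def\<close>)
  ultimately show ?thesis
    using arg_cong[OF id, of ?e] by (simp add: peval_diff)
qed

text \<open>The left side is what \<open>peval_psubst\<close> makes of \<open>concl_poly\<close> for
  a branch: both valuations keep the parameters and send each state variable to its updated
  value.\<close>

lemma peval_template_next_state:
  "peval (\<lambda>v. peval (joint_pt a x)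
      (case_sum (\<lambda>j. Var (Inl j)) (\<lambda>j. of_state (assignment P i $ j)) v)) (template P)
    = peval (joint_pt a (next_state P i x)) (template P)"
  by (rule arg_cong[where f = "\<lambda>s. peval s (template P)"])
    (auto simp: fun_eq_iff next_state_def split: sum.split)

text \<open>This ties the polynomial encoding to the logical implications:
  \<open>premise_polys\<close> and \<open>concl_poly\<close> evaluate to the premise and conclusion
  in each of the three kinds of condition.\<close>

lemma valid_partI:
  assumes a: "a \<in> param_set P"
    and concl: "\<And>x. x \<in> state_set P \<Longrightarrow>
      \<forall>q\<in>set (premise_polys P i). peval (joint_pt a x) q \<le> 0 \<Longrightarrow>
      peval (joint_pt a x) (concl_poly P i) \<le> 0"
  shows "a \<in> valid_part P i"
proof -
  consider "i = 0" | "i \<noteq> 0" "i \<le> num_branches P" | "i \<noteq> 0" "\<not> i \<le> num_branches P"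
    by blast
  then show ?thesis
  proof cases
    case 1
    then show ?thesis
      using a concl by (auto simp: valid_part_def premise_polys_def concl_poly_def tmpl_holds_def)
  next
    case 2
    then show ?thesis
      using a concl by (auto simp: valid_part_def premise_polys_def concl_poly_def tmpl_holds_def
          guard_holds_def peval_psubst peval_template_next_state)
  next
    case 3
    then show ?thesis
      \<comment> \<open>The exit condition is encoded by negated guards, hence
        \<open>peval_uminus\<close>. Keeping \<open>upt_Suc\<close> out leaves the list of branch
        indices whole, so that its set becomes the range from 1 to
        \<open>num_branches P\<close>.\<close>
      using a concl by (auto simp: valid_part_def premise_polys_def concl_poly_def tmpl_holds_def
          exit_holds_def peval_uminus atLeastLessThanSuc_atLeastAtMost simp del: upt_Suc)
  qed
qed

theorem theorem2:
  fixes P :: "('m::finite, 'n::finite) problem"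
    and M :: real
    and d :: nat
    and z :: "nat \<Rightarrow> ('m, 'n) sos_point"
  assumes "\<forall>i\<in>{1..num_branches P}. \<forall>j\<in>{1..num_branches P}. i \<noteq> j \<longrightarrow>
             {x. guard_holds P i x} \<inter> {x. guard_holds P j x} = {}"
    and "compact (state_set P)"
    and "reachable P \<subseteq> state_set P"
    and "compact (param_set P)"
    and "measure lebesgue (param_set P) > 0"
    and "M > 0"
    and "\<forall>i\<in>{0..num_branches P + 1}. \<forall>a\<in>param_set P. archimedean (K_module P i a)"
    and "archimedean (param_module P)"
    and "archimedean (state_module P)"
    and "\<forall>i\<in>{0..num_branches P + 1}. z i \<in> feasible (sos_program P M d i)"
  shows "under_set P (\<lambda>i. bound (z i)) \<subseteq> valid_set P"
proof
  fix a
  assume "a \<in> under_set P (\<lambda>i. bound (z i))"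
  \<comment> \<open>Even the first fact needs an index, because \<open>under_set\<close> mentions
    \<open>param_set P\<close> only inside the intersected parts.\<close>
  then have a: "a \<in> param_set P" "peval (pt a) (bound (z i)) \<le> 0"
    if "i \<in> {0..num_branches P + 1}" for i
    using that by (auto simp: under_set_def under_part_def)
  \<comment> \<open>Both intersections run over the same indices, so each condition is certified
    separately by its own feasible point \<open>z i\<close>.\<close>
  have "a \<in> valid_part P i" if i: "i \<in> {0..num_branches P + 1}" for i
  proof (rule valid_partI)
    show "a \<in> param_set P"
      using a(1) i .
    fix x
    assume "x \<in> state_set P"
      and "\<forall>q\<in>set (premise_polys P i). peval (joint_pt a x) q \<le> 0"
    then have "peval (joint_pt a x) (concl_poly P i) \<le> peval (pt a) (bound (z i))"
      using assms(10) i a(1) by (intro peval_concl_poly_le_bound) auto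
    also have "\<dots> \<le> 0"
      using a(2) i .
    finally show "peval (joint_pt a x) (concl_poly P i) \<le> 0" .
  qed
  then show "a \<in> valid_set P"
    by (simp add: valid_set_def)
qed

end
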